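(* Let $(X,d)$ be a metric space with $\dim_{\rm N} X \le n < \infty$. Then for all sufficiently small exponents $p \in (0,1)$, there exists a bi-Lipschitz embedding of the metric space $(X,d^p)$ into the product of $n+1$ metric trees.
   Context: A family $(B_i)_{i\in I}$ of subsets of a metric space $X=(X,d)$ is called $D$-bounded ($D \ge 0$) if $\operatorname{diam} B_i := \sup\{d(x,x') : x,x'\in B_i\} \le D$ for all $i$. For $s>0$, the $s$-multiplicity of the family is the infimum of all integers $n \ge 0$ such that every subset of $X$ with diameter $\le s$ meets at most $n$ members of the family. The Nagata dimension $\dim_{\rm N} X$ of a metric space $X$ is the infimum of all integers $n$ with the following property: there exists a constant $c>0$ such that for all $s>0$, $X$ has a $cs$-bounded covering with $s$-multiplicity at most $n+1$ (the value is $\infty$ if there is no such $n$). A metric tree is a geodesic metric space all of whose geodesic triangles are degenerate, in the sense that each side of the triangle is contained in the union of the other two (i.e. the triangle is isometric to a tripod); no local finiteness or compactness is assumed. Products of metric spaces carry the $\ell^2$ product metric. A bi-Lipschitz embedding $f \colon (A,d_A) \to (B,d_B)$ is a map for which there are constants $a,b>0$ with $a\,d_A(x,x') \le d_B(f(x),f(x')) \le b\,d_A(x,x')$ for all $x,x'\in A$. *)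

theory Defs
  imports "HOL-Analysis.Analysis"
begin

text \<open>Metric spaces are given by a carrier \<open>M\<close> and a distance function \<open>d\<close>, as in the library
  locale \<^locale>\<open>Metric_space\<close>; in particular the empty space is allowed.\<close>

section \<open>Nagata dimension\<close>

text \<open>The diameter is \<open>\<infinity>\<close> for unbounded sets; for the empty set it is the supremum of the empty set
  in \<^typ>\<open>ereal\<close>, i.e. \<open>-\<infinity>\<close>, so that the empty set has diameter at most any real number.\<close>

definition diam :: "('a \<Rightarrow> 'a \<Rightarrow> real) \<Rightarrow> 'a set \<Rightarrow> ereal" where
  "diam d A = (SUP x\<in>A. SUP x'\<in>A. ereal (d x x'))"

definition D_bounded :: "('a \<Rightarrow> 'a \<Rightarrow> real) \<Rightarrow> real \<Rightarrow> 'i set \<Rightarrow> ('i \<Rightarrow> 'a set) \<Rightarrow> bool" where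
  "D_bounded d D I B \<longleftrightarrow> (\<forall>i\<in>I. diam d (B i) \<le> ereal D)"

definition covering :: "'a set \<Rightarrow> 'i set \<Rightarrow> ('i \<Rightarrow> 'a set) \<Rightarrow> bool" where
  "covering M I B \<longleftrightarrow> (\<forall>i\<in>I. B i \<subseteq> M) \<and> M \<subseteq> (\<Union>i\<in>I. B i)"

definition multiplicity_at ::
    "'a set \<Rightarrow> ('a \<Rightarrow> 'a \<Rightarrow> real) \<Rightarrow> real \<Rightarrow> 'i set \<Rightarrow> ('i \<Rightarrow> 'a set) \<Rightarrow> enat" where
  "multiplicity_at M d s I B =
     Inf {enat n | n :: nat. \<forall>A\<subseteq>M. diam d A \<le> ereal s \<longrightarrow>
            finite {i \<in> I. B i \<inter> A \<noteq> {}} \<and> card {i \<in> I. B i \<inter> A \<noteq> {}} \<le> n}"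

text \<open>Families of subsets of \<open>M\<close> are indexed by sets of type \<^typ>\<open>'a set set\<close>. This is no
  restriction: discarding repeated members of a covering neither affects boundedness nor increases
  multiplicities, and a family without repetitions can be indexed by its own members.

  The infimum is over all integers, not just the nonnegative ones, so the empty space has
  dimension \<open>-1\<close>; no space has a smaller dimension because multiplicities are nonnegative.\<close>

definition nagata_property :: "'a set \<Rightarrow> ('a \<Rightarrow> 'a \<Rightarrow> real) \<Rightarrow> int \<Rightarrow> bool" where
  "nagata_property M d n \<longleftrightarrow>
     (\<exists>c>0. \<forall>s>0. \<exists>(I :: 'a set set) (B :: 'a set \<Rightarrow> 'a set).
        covering M I B \<and> D_bounded d (c * s) I B \<and>
        ereal_of_enat (multiplicity_at M d s I B) \<le> ereal (of_int (n + 1)))"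

definition nagata_dim :: "'a set \<Rightarrow> ('a \<Rightarrow> 'a \<Rightarrow> real) \<Rightarrow> ereal" where
  "nagata_dim M d = (INF n\<in>{n. nagata_property M d n}. ereal (of_int n))"

section \<open>Metric trees\<close>

definition geodesic_segment ::
    "'a set \<Rightarrow> ('a \<Rightarrow> 'a \<Rightarrow> real) \<Rightarrow> 'a \<Rightarrow> 'a \<Rightarrow> 'a set \<Rightarrow> bool" where
  "geodesic_segment M d x y S \<longleftrightarrow>
     (\<exists>\<gamma> :: real \<Rightarrow> 'a.
        \<gamma> ` {0..d x y} \<subseteq> M \<and> \<gamma> 0 = x \<and> \<gamma> (d x y) = y \<and>
        (\<forall>s\<in>{0..d x y}. \<forall>t\<in>{0..d x y}. d (\<gamma> s) (\<gamma> t) = \<bar>s - t\<bar>) \<and>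
        S = \<gamma> ` {0..d x y})"

definition geodesic_space :: "'a set \<Rightarrow> ('a \<Rightarrow> 'a \<Rightarrow> real) \<Rightarrow> bool" where
  "geodesic_space M d \<longleftrightarrow>
     Metric_space M d \<and> (\<forall>x\<in>M. \<forall>y\<in>M. \<exists>S. geodesic_segment M d x y S)"

definition metric_tree :: "'a set \<Rightarrow> ('a \<Rightarrow> 'a \<Rightarrow> real) \<Rightarrow> bool" where
  "metric_tree M d \<longleftrightarrow>
     geodesic_space M d \<and>
     (\<forall>x\<in>M. \<forall>y\<in>M. \<forall>z\<in>M. \<forall>S1 S2 S3.
        geodesic_segment M d x y S1 \<and> geodesic_segment M d y z S2 \<and> geodesic_segment M d z x S3
        \<longrightarrow> S1 \<subseteq> S2 \<union> S3 \<and> S2 \<subseteq> S3 \<union> S1 \<and> S3 \<subseteq> S1 \<union> S2)"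

section \<open>Products and bi-Lipschitz embeddings\<close>

definition l2_product_dist ::
    "'i set \<Rightarrow> ('i \<Rightarrow> 'a \<Rightarrow> 'a \<Rightarrow> real) \<Rightarrow> ('i \<Rightarrow> 'a) \<Rightarrow> ('i \<Rightarrow> 'a) \<Rightarrow> real" where
  "l2_product_dist I d u v = L2_set (\<lambda>i. d i (u i) (v i)) I"

definition bi_lipschitz_embedding ::
    "'a set \<Rightarrow> ('a \<Rightarrow> 'a \<Rightarrow> real) \<Rightarrow> 'b set \<Rightarrow> ('b \<Rightarrow> 'b \<Rightarrow> real) \<Rightarrow> ('a \<Rightarrow> 'b) \<Rightarrow> bool" where
  "bi_lipschitz_embedding A dA B dB f \<longleftrightarrow>
     f ` A \<subseteq> B \<and>
     (\<exists>a>0. \<exists>b>0. \<forall>x\<in>A. \<forall>x'\<in>A.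
        a * dA x x' \<le> dB (f x) (f x') \<and> dB (f x) (f x') \<le> b * dA x x')"

text \<open>HOL cannot quantify existentially over the types of the trees, so their points are taken from
  \<^typ>\<open>'a \<times> real\<close>, where \<^typ>\<open>'a\<close> is the type of points of \<open>X\<close>. This is no restriction: if \<open>f\<close>
  maps a nonempty \<open>X\<close> to a metric tree \<open>T\<close> of any type and \<open>x0 \<in> X\<close>, then the union \<open>T'\<close> of the
  geodesic segments from \<open>f x0\<close> to \<open>f x\<close>, \<open>x \<in> X\<close>, is again a metric tree, and picking for each
  \<open>y \<in> T'\<close> some \<open>x\<close> such that \<open>y\<close> lies on the segment from \<open>f x0\<close> to \<open>f x\<close>, one obtains an injection
  of \<open>T'\<close> into \<^typ>\<open>'a \<times> real\<close> sending \<open>y\<close> to the pair of \<open>x\<close> and the distance from \<open>f x0\<close> to \<open>y\<close>.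
  The factors are indexed by the \<open>n + 1\<close> integers in \<open>{0..n}\<close>.\<close>

definition embeds_in_product_of_trees :: "int \<Rightarrow> 'a set \<Rightarrow> ('a \<Rightarrow> 'a \<Rightarrow> real) \<Rightarrow> bool" where
  "embeds_in_product_of_trees n X \<rho> \<longleftrightarrow>
     (\<exists>(T :: int \<Rightarrow> ('a \<times> real) set) (dT :: int \<Rightarrow> 'a \<times> real \<Rightarrow> 'a \<times> real \<Rightarrow> real)
        (f :: 'a \<Rightarrow> int \<Rightarrow> 'a \<times> real).
        (\<forall>i\<in>{0..n}. metric_tree (T i) (dT i)) \<and>
        bi_lipschitz_embedding X \<rho> (PiE {0..n} T) (l2_product_dist {0..n} dT) f)"

end

theory Submission
  imports Defs
begin

text \<open>For each of the \<open>n + 1\<close> colours one tree is built, as the merge tree of a height function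
  \<open>u\<close> on \<open>X\<close>.

  At every scale \<open>s\<close> the Nagata condition yields a covering of \<open>X\<close> by \<open>n + 1\<close> families, one per colour,
  such that the members of each family have diameter at most \<open>c s\<close> and are \<open>3 s\<close> apart
  (\<open>nagata_coloured_coverings\<close>). Take these coverings at the scales \<open>r\<^sup>j\<close>, \<open>j\<close> an integer, for one large
  \<open>r\<close>. Fix a colour and let \<open>g\<^sub>j(x)\<close> be the distance from \<open>x\<close> to the union of the family at scale
  \<open>r\<^sup>j\<close>, truncated at \<open>r\<^sup>j\<close> and divided by \<open>r\<^sup>j\<close>. The height is the sum of the \<open>r\<^sup>j\<^sup>p g\<^sub>j\<close> over all \<open>j\<close>,
  renormalised at a base point. Between points at distance about \<open>r\<^sup>j\<close>, the terms of lower
  index contribute little because they are bounded by a geometric series in \<open>r\<^sup>-\<^sup>p\<close>, and those of higher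
  index contribute little because they are Lipschitz and \<open>p < 1\<close>; so up to a small multiple of
  \<open>r\<^sup>j\<^sup>p\<close> the height changes only through its \<open>j\<close>-th term (\<open>multiscale_sum\<close>). Consequently each member
  \<open>C\<close> of the family at scale \<open>r\<^sup>j\<close> is surrounded by a wall, formed by the points with distance between \<open>r\<^sup>j\<close> and
  \<open>2 r\<^sup>j\<close> from \<open>C\<close>, on which the height exceeds the height at any point of \<open>C\<close> by at least half of \<open>r\<^sup>j\<^sup>p\<close>.

  Now let the cost of a jump from \<open>a\<close> to \<open>b\<close> be the larger one of \<open>u(a)\<close> and \<open>u(b)\<close>, plus \<open>d(a, b)\<^sup>p\<close>, and let
  \<open>U(x, y)\<close> be the bottleneck cost, i.e. the infimum over all chains from \<open>x\<close> to \<open>y\<close> of the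
  largest cost of a jump. Then \<open>U\<close> satisfies the ultrametric inequality, and \<open>U(x, x) = u(x)\<close>. Climbing
  from each \<open>x\<close>, starting at the height \<open>u(x)\<close>, and merging the rays of \<open>x\<close> and \<open>y\<close> at the height
  \<open>U(x, y)\<close> gives a metric tree in which the distance between the starting points of \<open>x\<close> and \<open>y\<close> is
  \<open>2 U(x, y) - u(x) - u(y)\<close> (\<open>merging_heights_embed_in_metric_tree\<close>). A single jump bounds this distance
  above by a multiple of \<open>d(x, y)\<^sup>p\<close>. If \<open>x\<close> lies in \<open>C\<close> and \<open>y\<close> outside the
  \<open>r\<^sup>j\<close>-neighbourhood of \<open>C\<close>, then the jump by which a chain leaves this neighbourhood either lands on the wall
  or has length at least \<open>r\<^sup>j\<close>, so that the distance is at least half of \<open>r\<^sup>j\<^sup>p\<close> (\<open>tree_of_scattered_families\<close>).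
  Every pair \<open>x, y\<close> is treated in this way at the scale comparable to \<open>d(x, y)\<close>, in the colour of a
  family that contains \<open>x\<close>. The argument works for every exponent \<open>p\<close> in \<open>(0, 1)\<close>, with \<open>r\<close> depending
  on \<open>p\<close>.\<close>

section \<open>The Nagata property\<close>

lemma nagata_property_mono:
  assumes "nagata_property M d m" "m \<le> n"
  shows "nagata_property M d n"
proof -
  have "ereal (of_int (m + 1)) \<le> ereal (of_int (n + 1))" using assms(2) by simp
  from order_trans[OF _ this] show ?thesis
    using assms(1) unfolding nagata_property_def by meson
qed

text \<open>The infimum ranges over integers, so if it is at most \<open>n\<close>, then it is below \<open>n + 1\<close> and some integer
  that is at most \<open>n\<close> has the property.\<close>

lemma nagata_property_of_dim_le:
  assumes "nagata_dim M d \<le> ereal (of_int n)"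
  shows "nagata_property M d n"
proof (rule ccontr)
  assume not: "\<not> nagata_property M d n"
  have "ereal (of_int (n + 1)) \<le> ereal (of_int m)" if "nagata_property M d m" for m
    using not nagata_property_mono[OF that, of n] by (cases "m \<le> n") auto
  then have "ereal (of_int (n + 1)) \<le> nagata_dim M d"
    unfolding nagata_dim_def by (intro INF_greatest) simp
  also note assms
  finally show False by simp
qed

lemma diam_le_iff: "diam d A \<le> ereal s \<longleftrightarrow> (\<forall>x\<in>A. \<forall>y\<in>A. d x y \<le> s)"
  by (simp add: diam_def SUP_le_iff)

lemma multiplicity_at_le_imp_card_le:
  assumes mult: "ereal_of_enat (multiplicity_at M d s I B) \<le> ereal (of_int m)"
    and A: "A \<subseteq> M" "\<And>x y. \<lbrakk>x \<in> A; y \<in> A\<rbrakk> \<Longrightarrow> d x y \<le> s"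
  shows "finite {i \<in> I. B i \<inter> A \<noteq> {}} \<and> int (card {i \<in> I. B i \<inter> A \<noteq> {}}) \<le> m"
proof -
  let ?N = "{enat n | n :: nat. \<forall>A\<subseteq>M. diam d A \<le> ereal s \<longrightarrow>
            finite {i \<in> I. B i \<inter> A \<noteq> {}} \<and> card {i \<in> I. B i \<inter> A \<noteq> {}} \<le> n}"
  have "?N \<noteq> {}"
  proof
    assume "?N = {}"
    then have "multiplicity_at M d s I B = Inf {}"
      unfolding multiplicity_at_def by (rule arg_cong)
    then show False using mult by (simp add: top_enat_def)
  qed
  then obtain e where "e \<in> ?N" by auto
  then have "multiplicity_at M d s I B \<in> ?N"
    unfolding multiplicity_at_def by (rule wellorder_InfI)
  then obtain k where k: "multiplicity_at M d s I B = enat k"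
    "\<forall>A\<subseteq>M. diam d A \<le> ereal s \<longrightarrow>
            finite {i \<in> I. B i \<inter> A \<noteq> {}} \<and> card {i \<in> I. B i \<inter> A \<noteq> {}} \<le> k"
    by blast
  have "int k \<le> m" using mult k(1) by simp
  moreover have "diam d A \<le> ereal s" using A by (simp add: diam_le_iff)
  then have "finite {i \<in> I. B i \<inter> A \<noteq> {}} \<and> card {i \<in> I. B i \<inter> A \<noteq> {}} \<le> k"
    using k(2) A(1) by blast
  ultimately show ?thesis by linarith
qed

section \<open>Truncated distance to a set\<close>

text \<open>Truncation makes the distance to the empty set meaningful (it is the bound \<open>h\<close>) and makes the
  distance sensitive only to sets that meet the ball of radius \<open>h\<close>.\<close>

definition trunc_dist :: "('a \<Rightarrow> 'a \<Rightarrow> real) \<Rightarrow> real \<Rightarrow> 'a set \<Rightarrow> 'a \<Rightarrow> real" where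
  "trunc_dist d h B x = Inf (insert h (d x ` B))"

context Metric_space
begin

lemma trunc_dist_bounds: "0 \<le> h \<Longrightarrow> 0 \<le> trunc_dist d h B x \<and> trunc_dist d h B x \<le> h"
proof -
  assume h: "0 \<le> h"
  then have "bdd_below (insert h (d x ` B))" by (intro bdd_belowI[of _ 0]) auto
  then show ?thesis
    using h unfolding trunc_dist_def by (auto intro!: cInf_greatest cInf_lower)
qed

lemma trunc_dist_le: "\<lbrakk>0 \<le> h; b \<in> B\<rbrakk> \<Longrightarrow> trunc_dist d h B x \<le> d x b"
  unfolding trunc_dist_def by (rule cInf_lower) (auto intro!: bdd_belowI[of _ 0])

lemma trunc_dist_ge:
  "\<lbrakk>a \<le> h; \<And>b. b \<in> B \<Longrightarrow> a \<le> d x b\<rbrakk> \<Longrightarrow> a \<le> trunc_dist d h B x"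
  unfolding trunc_dist_def by (rule cInf_greatest) auto

lemma trunc_dist_less_imp: "trunc_dist d h B x < h \<Longrightarrow> \<exists>b\<in>B. d x b < h"
  using trunc_dist_ge[of h h B x] by force

lemma trunc_dist_lipschitz:
  assumes "0 \<le> h" "B \<subseteq> M" "x \<in> M" "y \<in> M"
  shows "\<bar>trunc_dist d h B x - trunc_dist d h B y\<bar> \<le> d x y"
proof -
  have "trunc_dist d h B x - d x y \<le> trunc_dist d h B y" if "x \<in> M" "y \<in> M" for x y
  proof (rule trunc_dist_ge)
    show "trunc_dist d h B x - d x y \<le> h" using trunc_dist_bounds[OF assms(1), of B x] nonneg[of x y] by linarith
    show "trunc_dist d h B x - d x y \<le> d y b" if "b \<in> B" for b
      using trunc_dist_le[OF assms(1) that, of x] triangle[of x y b] \<open>x \<in> M\<close> \<open>y \<in> M\<close> that assms(2) by force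
  qed
  from this[of x y] this[of y x] show ?thesis using assms commute[of x y] by force
qed

lemma trunc_dist_mem: "\<lbrakk>0 \<le> h; x \<in> B; x \<in> M\<rbrakk> \<Longrightarrow> trunc_dist d h B x = 0"
  using trunc_dist_le[of h x B x] trunc_dist_bounds[of h B x] zero[of x x] by simp

end

section \<open>Coloured coverings from the Nagata dimension\<close>

lemma strict_chain_length_less_card:
  fixes S :: "nat \<Rightarrow> 'b set"
  assumes "\<And>m. m < N \<Longrightarrow> S m \<subset> S (Suc m)" and "finite (S N)" and "S 0 \<noteq> {}"
  shows "N < card (S N)"
  using assms
proof (induction N)
  case 0
  then show ?case by (simp add: card_gt_0_iff)
next
  case (Suc N)
  have sub: "S N \<subset> S (Suc N)" using Suc.prems(1) by blast
  then have "finite (S N)" using Suc.prems(2) finite_subset by blast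
  then have "Suc N \<le> card (S N)" using Suc.IH Suc.prems by simp
  also have "card (S N) < card (S (Suc N))" using Suc.prems(2) sub by (rule psubset_card_mono)
  finally show ?case .
qed

text \<open>At most \<open>N\<close> values are below \<open>(N + 1) g\<close>, and one of them is nonpositive. So the \<open>N + 1\<close> nested sets of
  indices with value below \<open>g\<close>, \<open>2 g\<close>, ..., \<open>(N + 1) g\<close> have between \<open>1\<close> and \<open>N\<close> elements each, two
  consecutive ones agree, and no value lies between the corresponding thresholds.\<close>

lemma exists_gap:
  fixes \<delta> :: "'b \<Rightarrow> real"
  assumes g: "0 < g"
    and near: "finite {i\<in>I. \<delta> i < (real N + 1) * g}" "card {i\<in>I. \<delta> i < (real N + 1) * g} \<le> N"
    and ex: "i0 \<in> I" "\<delta> i0 \<le> 0"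
  shows "\<exists>S\<subseteq>I. finite S \<and> S \<noteq> {} \<and> card S \<le> N \<and> (\<forall>i\<in>S. \<delta> i < (real N + 1) * g) \<and>
     (\<forall>i\<in>S. \<forall>k\<in>I - S. \<delta> i + g \<le> \<delta> k)"
proof -
  define S where "S m = {i\<in>I. \<delta> i < (real m + 1) * g}" for m
  have mono: "S l \<subseteq> S m" if "l \<le> m" for l m
  proof -
    have "(real l + 1) * g \<le> (real m + 1) * g" using g that by simp
    then show ?thesis by (auto simp: S_def)
  qed
  have ne: "S 0 \<noteq> {}" using ex g by (auto simp: S_def)
  have top: "finite (S N)" "card (S N) \<le> N" using near by (auto simp: S_def)
  have "\<exists>m<N. S m = S (Suc m)"
  proof (rule ccontr)
    assume "\<not> ?thesis"
    then have "S m \<subset> S (Suc m)" if "m < N" for m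
      using mono[of m "Suc m"] that by auto
    then show False using strict_chain_length_less_card[of N S] ne top by simp
  qed
  then obtain m where m: "m < N" "S m = S (Suc m)" by blast
  have sub: "S m \<subseteq> S N" using mono m by simp
  have "\<delta> i + g \<le> \<delta> k" if "i \<in> S m" "k \<in> I - S m" for i k
  proof -
    have "\<delta> i < (real m + 1) * g" using that by (simp add: S_def)
    moreover have "(real (Suc m) + 1) * g \<le> \<delta> k" using that unfolding m(2) by (auto simp: S_def)
    ultimately show ?thesis by (simp add: algebra_simps)
  qed
  moreover have "S m \<noteq> {}" using ne mono[of 0 m] by auto
  moreover have "finite (S m)" "card (S m) \<le> N"
    using sub top card_mono[of "S N" "S m"] finite_subset by auto
  moreover have "S m \<subseteq> I" "\<forall>i\<in>S m. \<delta> i < (real N + 1) * g"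
    using sub by (auto simp: S_def)
  ultimately show ?thesis by blast
qed

text \<open>The separation \<open>3 s\<close> leaves room for a wall around each member: a point within \<open>2 s\<close> of
  one member has distance at least \<open>s\<close> from all the others.\<close>

definition scattered :: "('a \<Rightarrow> 'a \<Rightarrow> real) \<Rightarrow> real \<Rightarrow> real \<Rightarrow> 'a set set \<Rightarrow> bool" where
  "scattered d c s F \<longleftrightarrow> (\<forall>C\<in>F. \<forall>x\<in>C. \<forall>y\<in>C. d x y \<le> c * s) \<and>
     (\<forall>C\<in>F. \<forall>C'\<in>F. C \<noteq> C' \<longrightarrow> (\<forall>x\<in>C. \<forall>y\<in>C'. 3 * s \<le> d x y))"

text \<open>Given a covering \<open>(B\<^sub>i)\<close> of multiplicity at most \<open>n + 1\<close> at scale \<open>2 h\<close>, assign to a finite nonempty set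
  \<open>S\<close> of indices the set \<open>A(S)\<close> of all points that are close to every \<open>B\<^sub>i\<close>, \<open>i \<in> S\<close>, and by a definite
  amount closer to each of these than to all other \<open>B\<^sub>k\<close>. Every point lies in some \<open>A(S)\<close> with at most
  \<open>n + 1\<close> indices, because its distances to the few \<open>B\<^sub>i\<close> near it have a gap.
  The colour of \<open>A(S)\<close> is one less than the cardinality of \<open>S\<close>. If \<open>S\<close> and \<open>S'\<close> are distinct
  and have the same colour, then neither contains the other, so on the way from \<open>A(S)\<close> to \<open>A(S')\<close> the order of
  the distances to some \<open>B\<^sub>i\<close> and some \<open>B\<^sub>k\<close> is reversed, which keeps the two sets apart. For
  \<open>n = -1\<close> there are no colours, and \<open>M\<close> is empty.\<close>

lemma (in Metric_space) nagata_coloured_coverings: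
  assumes "nagata_property M d n"
  shows "\<exists>c>0. \<forall>s>0. \<exists>F :: int \<Rightarrow> 'a set set.
    M \<subseteq> (\<Union>k\<in>{0..n}. \<Union> (F k)) \<and> (\<forall>k. \<Union> (F k) \<subseteq> M \<and> scattered d c s (F k))"
proof -
  define N where "N = nat (n + 1)"
  obtain c0 where c0: "c0 > 0" and cover: "\<And>s. s > 0 \<Longrightarrow> \<exists>(I :: 'a set set) (B :: 'a set \<Rightarrow> 'a set).
        covering M I B \<and> D_bounded d (c0 * s) I B \<and>
        ereal_of_enat (multiplicity_at M d s I B) \<le> ereal (of_int (n + 1))"
    using assms unfolding nagata_property_def by blast
  define c where "c = 6 * (real N + 1) * (c0 + 1)"
  have "\<exists>F :: int \<Rightarrow> 'a set set.
    M \<subseteq> (\<Union>k\<in>{0..n}. \<Union> (F k)) \<and> (\<forall>k. \<Union> (F k) \<subseteq> M \<and> scattered d c s (F k))"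
    if s: "s > 0" for s
  proof -
    \<comment> \<open>Here \<open>3 s\<close> is the size of the gap; fitting \<open>N + 1\<close> gaps below \<open>h\<close> forces one of them to be free.\<close>
    define h where "h = (real N + 1) * (3 * s)"
    have h: "h > 0" using s by (simp add: h_def)
    obtain I :: "'a set set" and B :: "'a set \<Rightarrow> 'a set" where cov: "covering M I B"
      and bdd: "D_bounded d (c0 * (2 * h)) I B"
      and mult: "ereal_of_enat (multiplicity_at M d (2 * h) I B) \<le> ereal (of_int (n + 1))"
      using cover[of "2 * h"] h by auto
    have B: "B i \<subseteq> M" "\<lbrakk>x \<in> B i; y \<in> B i\<rbrakk> \<Longrightarrow> d x y \<le> c0 * (2 * h)" if "i \<in> I" for i x y
      using cov bdd that by (auto simp: covering_def D_bounded_def diam_le_iff)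
    define \<delta> where "\<delta> i = trunc_dist d h (B i)" for i
    define A where "A S = {x\<in>M. (\<forall>i\<in>S. \<delta> i x < h) \<and> (\<forall>i\<in>S. \<forall>k\<in>I - S. \<delta> i x + 3 * s \<le> \<delta> k x)}" for S
    define F where "F k = A ` {S. S \<subseteq> I \<and> S \<noteq> {} \<and> finite S \<and> int (card S) = k + 1}" for k
    have lip: "\<bar>\<delta> i x - \<delta> i y\<bar> \<le> d x y" if "i \<in> I" "x \<in> M" "y \<in> M" for i x y
      unfolding \<delta>_def using trunc_dist_lipschitz h B(1) that by simp
    have covers: "\<exists>k\<in>{0..n}. \<exists>C\<in>F k. x \<in> C" if x: "x \<in> M" for x
    proof -
      let ?ball = "{y\<in>M. d x y < h}"
      have "d y z \<le> 2 * h" if "y \<in> ?ball" "z \<in> ?ball" for y z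
        using that x triangle[of y x z] commute[of y x] by auto
      \<comment> \<open>The open ball of radius \<open>h\<close> around \<open>x\<close> is a set to which the multiplicity bound at scale \<open>2 h\<close> applies.\<close>
      then have fin: "finite {i \<in> I. B i \<inter> ?ball \<noteq> {}}" "int (card {i \<in> I. B i \<inter> ?ball \<noteq> {}}) \<le> n + 1"
        using multiplicity_at_le_imp_card_le[OF mult, of ?ball] by auto
      have sub: "{i\<in>I. \<delta> i x < (real N + 1) * (3 * s)} \<subseteq> {i \<in> I. B i \<inter> ?ball \<noteq> {}}"
        using trunc_dist_less_imp[of h] B(1) unfolding \<delta>_def h_def[symmetric] by fastforce
      obtain i0 where i0: "i0 \<in> I" "x \<in> B i0" using cov x by (auto simp: covering_def)
      then have "\<delta> i0 x \<le> 0" using trunc_dist_mem[of h] h x by (simp add: \<delta>_def)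
      moreover have "card {i\<in>I. \<delta> i x < (real N + 1) * (3 * s)} \<le> N"
        using card_mono[OF fin(1) sub] fin(2) by (simp add: N_def)
      ultimately obtain S where S: "S \<subseteq> I" "finite S" "S \<noteq> {}" "card S \<le> N"
        "\<forall>i\<in>S. \<delta> i x < (real N + 1) * (3 * s)" "\<forall>i\<in>S. \<forall>k\<in>I - S. \<delta> i x + 3 * s \<le> \<delta> k x"
        using exists_gap[of "3 * s" I "\<lambda>i. \<delta> i x" N i0] i0(1) s finite_subset[OF sub fin(1)] by auto
      have "x \<in> A S" using S(5,6) x by (simp add: A_def h_def)
      moreover have "A S \<in> F (int (card S) - 1)" using S by (auto simp: F_def)
      moreover have "int (card S) - 1 \<in> {0..n}"
        using S(2-4) card_gt_0_iff[of S] by (simp add: N_def)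
      ultimately show ?thesis by blast
    qed
    have bounded: "d x y \<le> c * s" if "C \<in> F k" "x \<in> C" "y \<in> C" for k C x y
    proof -
      obtain S i where S: "C = A S" "S \<subseteq> I" "i \<in> S" using \<open>C \<in> F k\<close> by (auto simp: F_def)
      then have "i \<in> I" and mem: "x \<in> M" "y \<in> M" and "\<delta> i x < h" "\<delta> i y < h"
        using that by (auto simp: A_def)
      then obtain a b where ab: "a \<in> B i" "b \<in> B i" "d x a < h" "d y b < h"
        using trunc_dist_less_imp unfolding \<delta>_def by meson
      have "a \<in> M" "b \<in> M" "d a b \<le> c0 * (2 * h)" using B[OF \<open>i \<in> I\<close>] ab by auto
      then have "d x y \<le> h + c0 * (2 * h) + h"
        using triangle[of x a y] triangle[of a b y] mem ab commute[of b y] by linarith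
      also have "\<dots> = c * s" by (simp add: c_def h_def algebra_simps)
      finally show ?thesis .
    qed
    have separated: "3 * s \<le> d x y"
      if C: "C \<in> F k" "C' \<in> F k" "C \<noteq> C'" and xy: "x \<in> C" "y \<in> C'" for k C C' x y
    proof -
      obtain S S' where S: "C = A S" "S \<subseteq> I" "finite S" "C' = A S'" "S' \<subseteq> I" "finite S'"
        "card S = card S'" "S \<noteq> S'" using C unfolding F_def by (smt (verit) imageE mem_Collect_eq of_nat_eq_iff)
      then have "\<not> S \<subseteq> S'" "\<not> S' \<subseteq> S"
        using card_subset_eq[of S S'] card_subset_eq[of S' S] by auto
      then obtain i i' where i: "i \<in> S" "i \<notin> S'" "i' \<in> S'" "i' \<notin> S" by blast
      then have "\<delta> i x + 3 * s \<le> \<delta> i' x" "\<delta> i' y + 3 * s \<le> \<delta> i y" and "x \<in> M" "y \<in> M"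
        using xy S by (auto simp: A_def)
      moreover from this have "\<bar>\<delta> i x - \<delta> i y\<bar> \<le> d x y" "\<bar>\<delta> i' x - \<delta> i' y\<bar> \<le> d x y"
        using lip i S by auto
      ultimately show ?thesis by linarith
    qed
    have "\<Union> (F k) \<subseteq> M" for k by (auto simp: F_def A_def)
    moreover have "scattered d c s (F k)" for k
      using bounded[of _ k] separated[of _ k] unfolding scattered_def by simp
    moreover have "M \<subseteq> (\<Union>k\<in>{0..n}. \<Union> (F k))" using covers by blast
    ultimately show ?thesis by (intro exI[of _ F]) simp
  qed
  moreover have "c > 0" using c0 by (simp add: c_def)
  ultimately show ?thesis by blast
qed

section \<open>Multiscale height functions\<close>

lemma two_sided_geometric_sum:
  fixes f :: "int \<Rightarrow> real"
  assumes q: "q > 1" and t: "t > 1"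
    and below: "\<And>m::nat. \<bar>f (j - 1 - int m)\<bar> \<le> A * (1 / q) ^ m"
    and above: "\<And>m::nat. \<bar>f (j + 1 + int m)\<bar> \<le> B * (1 / t) ^ m"
  shows "f summable_on UNIV" "\<bar>infsum f UNIV - f j\<bar> \<le> A * q / (q - 1) + B * t / (t - 1)"
proof -
  have geo: "((\<lambda>m. C * (1 / a) ^ m) has_sum (C * a / (a - 1))) UNIV" and nonneg: "0 \<le> C"
    if "a > 1" "\<And>m::nat. \<bar>h m\<bar> \<le> C * (1 / a) ^ m" for C a :: real and h
  proof -
    show C: "0 \<le> C" using that(2)[of 0] by simp
    have "(\<lambda>m. C * (1 / a) ^ m) sums (C * (1 / (1 - 1 / a)))"
      using that(1) by (intro sums_mult geometric_sums) simp
    also have "C * (1 / (1 - 1 / a)) = C * a / (a - 1)"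
      using that(1) by (simp add: field_simps)
    finally show "((\<lambda>m. C * (1 / a) ^ m) has_sum (C * a / (a - 1))) UNIV"
      using C that(1) by (intro sums_nonneg_imp_has_sum) auto
  qed
  have half: "h summable_on UNIV \<and> \<bar>infsum h UNIV\<bar> \<le> C * a / (a - 1)"
    if "a > 1" "\<And>m::nat. \<bar>h m\<bar> \<le> C * (1 / a) ^ m" for C a :: real and h :: "nat \<Rightarrow> real"
  proof -
    have "(\<lambda>m. C * (1 / a) ^ m) = (\<lambda>m. norm (C * (1 / a) ^ m))"
      using nonneg[OF that] that(1) by auto
    then have g: "(\<lambda>m. norm (C * (1 / a) ^ m)) summable_on UNIV"
      using geo[OF that] has_sum_imp_summable by metis
    have "(\<lambda>m. norm (h m)) summable_on UNIV"
      by (rule Infinite_Sum.abs_summable_on_comparison_test[OF g])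
        (use that(2) in \<open>simp add: order_trans[OF _ abs_ge_self]\<close>)
    then have sum: "h summable_on UNIV" by (rule abs_summable_summable)
    then show ?thesis
      using norm_infsum_le[OF has_sum_infsum[OF sum] geo[OF that]] that(2) by simp
  qed
  have lo: "{..<j} = range (\<lambda>m. j - 1 - int m)"
  proof (intro equalityI subsetI)
    fix i assume "i \<in> {..<j}"
    then show "i \<in> range (\<lambda>m. j - 1 - int m)" by (intro range_eqI[of _ _ "nat (j - 1 - i)"]) simp
  qed auto
  have hi: "{j<..} = range (\<lambda>m. j + 1 + int m)"
  proof (intro equalityI subsetI)
    fix i assume "i \<in> {j<..}"
    then show "i \<in> range (\<lambda>m. j + 1 + int m)" by (intro range_eqI[of _ _ "nat (i - j - 1)"]) simp
  qed auto
  have L: "f summable_on {..<j} \<and> \<bar>infsum f {..<j}\<bar> \<le> A * q / (q - 1)"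
    unfolding lo using half[OF q below]
    by (subst summable_on_reindex infsum_reindex, simp add: inj_def)+ (simp add: o_def)
  have R: "f summable_on {j<..} \<and> \<bar>infsum f {j<..}\<bar> \<le> B * t / (t - 1)"
    unfolding hi using half[OF t above]
    by (subst summable_on_reindex infsum_reindex, simp add: inj_def)+ (simp add: o_def)
  have U: "UNIV = insert j ({..<j} \<union> {j<..})" by auto
  have sum: "f summable_on ({..<j} \<union> {j<..})"
    using L R by (intro summable_on_Un_disjoint) auto
  then show "f summable_on UNIV"
    unfolding U by (simp add: summable_on_insert_iff)
  have "infsum f UNIV = f j + (infsum f {..<j} + infsum f {j<..})"
    unfolding U using sum L R
    by (subst infsum_insert) (auto intro!: infsum_Un_disjoint)
  then show "\<bar>infsum f UNIV - f j\<bar> \<le> A * q / (q - 1) + B * t / (t - 1)"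
    using L R by linarith
qed

text \<open>Up to an error of half its scale \<open>r\<^sup>j\<^sup>p\<close>, the \<open>j\<close>-th term alone governs the variation of the sum over
  distances of order \<open>r\<^sup>j\<close>. The terms below \<open>j\<close> are bounded by a geometric series with ratio
  \<open>r\<^sup>-\<^sup>p\<close>. The \<open>i\<close>-th term, \<open>i > j\<close>, varies by at most \<open>r\<^sup>i\<^sup>p E r\<^sup>j / r\<^sup>i\<close>, a geometric
  series with ratio \<open>r\<^sup>p / r\<close>. The two lower bounds on powers of \<open>r\<close> make each of the two series at most
  a quarter of \<open>r\<^sup>j\<^sup>p\<close>.\<close>

lemma (in Metric_space) multiscale_sum:
  fixes g :: "int \<Rightarrow> 'a \<Rightarrow> real" and r p E :: real
  assumes r: "r > 1"
    and q_big: "r powr p \<ge> 5" and t_big: "r powr (1 - p) \<ge> 4 * E + 1" and E: "E \<ge> 1"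
    and g: "\<And>j x. 0 \<le> g j x \<and> g j x \<le> 1"
    and g_lip: "\<And>j x y. \<lbrakk>x \<in> M; y \<in> M\<rbrakk> \<Longrightarrow> \<bar>g j x - g j y\<bar> \<le> d x y / r powr j"
  shows "\<exists>u. \<forall>x\<in>M. \<forall>y\<in>M. \<forall>j::int. d x y \<le> E * r powr j \<longrightarrow>
    \<bar>u x - u y - r powr (p * j) * (g j x - g j y)\<bar> \<le> r powr (p * j) / 2"
proof (cases "M = {}")
  case False
  then obtain b where b: "b \<in> M" by blast
  let ?f = "\<lambda>x y i. r powr (p * of_int i) * (g i x - g i y)"
  \<comment> \<open>The terms with large index need not tend to \<open>0\<close>; their differences are summable, whence the base point.\<close>
  define u where "u x = infsum (?f x b) UNIV" for x
  define q where "q = r powr p"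
  define t where "t = r powr (1 - p)"
  have q: "q \<ge> 5" and t: "t \<ge> 4 * E + 1" and pos: "0 < r"
    using q_big t_big r by (auto simp: q_def t_def)
  have est: "?f x y summable_on UNIV \<and> \<bar>infsum (?f x y) UNIV - ?f x y j\<bar> \<le> r powr (p * j) / 2"
    if xy: "x \<in> M" "y \<in> M" and dist: "d x y \<le> E * r powr j" for x y and j :: int
  proof -
    let ?a = "r powr (p * j)"
    have below: "\<bar>?f x y (j - 1 - int m)\<bar> \<le> ?a / q * (1 / q) ^ m" for m
    proof -
      have "\<bar>g i x - g i y\<bar> \<le> 1" for i using g[of i x] g[of i y] by auto
      then have le: "\<bar>?f x y (j - 1 - int m)\<bar> \<le> r powr (p * of_int (j - 1 - int m)) * 1"
        unfolding abs_mult by (intro mult_mono) auto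
      have "r powr (p * of_int (j - 1 - int m)) = ?a / q * (1 / q) ^ m"
        using pos unfolding q_def
        by (simp add: powr_diff powr_powr[symmetric] powr_realpow power_divide right_diff_distrib algebra_simps powr_add)
      with le show ?thesis by (simp only: mult_1_right)
    qed
    have above: "\<bar>?f x y (j + 1 + int m)\<bar> \<le> E * ?a / t * (1 / t) ^ m" for m
    proof -
      let ?i = "j + 1 + int m"
      have "\<bar>g ?i x - g ?i y\<bar> \<le> E * r powr j / r powr ?i"
        using g_lip[OF xy, of ?i] dist by (meson divide_right_mono order_trans powr_ge_zero)
      then have "\<bar>?f x y ?i\<bar> \<le> r powr (p * of_int ?i) * (E * r powr j / r powr ?i)"
        unfolding abs_mult by (intro mult_mono) auto
      also have "\<dots> = E * r powr (p * of_int ?i + j - ?i)"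
        by (simp add: powr_diff powr_add)
      also have "p * of_int ?i + real_of_int j - ?i = p * j - (1 - p) - (1 - p) * real m"
        by (simp add: algebra_simps)
      also have "E * r powr (p * j - (1 - p) - (1 - p) * real m) = E * ?a / t * (1 / t) ^ m"
        using pos unfolding t_def
        by (simp add: powr_diff powr_powr[symmetric] powr_realpow power_divide)
      finally show ?thesis .
    qed
    have q1: "q > 1" and t1: "t > 1" using q t E by auto
    note geo = two_sided_geometric_sum[OF q1 t1 below above]
    have "?a / q * q / (q - 1) \<le> ?a / 4"
    proof -
      have "?a / (q - 1) \<le> ?a / 4"
        using q by (intro divide_left_mono) auto
      then show ?thesis using q by simp
    qed
    moreover have "E * ?a / t * t / (t - 1) \<le> ?a / 4"
    proof -
      have "E * ?a / (t - 1) \<le> E * ?a / (4 * E)"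
        using t E by (intro divide_left_mono) auto
      then show ?thesis using E t1 by simp
    qed
    ultimately show ?thesis using geo by linarith
  qed
  have scale: "\<exists>j::int. d x y \<le> E * r powr j" for x y
  proof -
    obtain m where m: "d x y < r ^ m" using real_arch_pow[OF r] by blast
    have "r ^ m = r powr int m" using pos by (simp add: powr_realpow)
    with m E have "d x y \<le> E * r powr (int m)"
      by (smt (verit) mult_le_cancel_right1 powr_ge_zero)
    then show ?thesis by blast
  qed
  have diff: "u x - u y = infsum (?f x y) UNIV" if xy: "x \<in> M" "y \<in> M" for x y
  proof -
    have "?f x b summable_on UNIV" "?f y b summable_on UNIV"
      using scale est xy b by blast+
    then have "((\<lambda>i. ?f x b i + - ?f y b i) has_sum (u x + - u y)) UNIV"
      unfolding u_def by (intro has_sum_add has_sum_uminusI has_sum_infsum)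
    then have "u x - u y = infsum (\<lambda>i. ?f x b i + - ?f y b i) UNIV"
      by (simp add: infsumI)
    also have "(\<lambda>i. ?f x b i + - ?f y b i) = ?f x y" by (auto simp: algebra_simps)
    finally show ?thesis .
  qed
  show ?thesis
    by (rule exI[of _ u]) (use est diff in auto)
qed auto

section \<open>Metric trees and the four-point condition\<close>

text \<open>The point \<open>q\<close> of the segment at distance \<open>d y p\<close> from \<open>y\<close> has the same distances to \<open>y\<close> and \<open>z\<close> as \<open>p\<close>.
  The four-point condition for \<open>p, q\<close> and \<open>y, z\<close> then leaves no room between \<open>p\<close> and \<open>q\<close>.\<close>

lemma between_mem_geodesic_segment:
  assumes M: "Metric_space M d"
    and four_point: "\<And>x y z w. \<lbrakk>x \<in> M; y \<in> M; z \<in> M; w \<in> M\<rbrakk>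
       \<Longrightarrow> d x y + d z w \<le> max (d x z + d y w) (d x w + d y z)"
    and S: "geodesic_segment M d y z S" and mem: "y \<in> M" "z \<in> M" "p \<in> M"
    and between: "d y p + d p z = d y z"
  shows "p \<in> S"
proof -
  interpret Metric_space M d by (fact M)
  obtain \<gamma> where im: "\<gamma> ` {0..d y z} \<subseteq> M" and ends: "\<gamma> 0 = y" "\<gamma> (d y z) = z"
    and iso: "\<And>s t. \<lbrakk>s \<in> {0..d y z}; t \<in> {0..d y z}\<rbrakk> \<Longrightarrow> d (\<gamma> s) (\<gamma> t) = \<bar>s - t\<bar>"
    and S_eq: "S = \<gamma> ` {0..d y z}"
    using S unfolding geodesic_segment_def by blast
  define q where "q = \<gamma> (d y p)"
  have t: "d y p \<in> {0..d y z}" using between nonneg[of p z] nonneg[of y p] by (simp del: nonneg)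
  then have "q \<in> M" "q \<in> S" using im S_eq by (auto simp: q_def)
  have "d y q = d y p"
    using iso[of 0 "d y p"] t ends by (simp add: q_def)
  moreover have "d q z = d p z"
    using iso[of "d y p" "d y z"] t ends between by (simp add: q_def)
  ultimately have "d p q \<le> 0"
    using four_point[of p q y z] mem \<open>q \<in> M\<close> between commute[of p y] commute[of q y] by simp
  then have "p = q"
    using mem \<open>q \<in> M\<close> nonneg[of p q] zero[of p q] by linarith
  then show ?thesis using \<open>q \<in> S\<close> by simp
qed

text \<open>By the four-point condition, a point \<open>p\<close> on the side from \<open>x\<close> to \<open>y\<close> lies between \<open>y\<close> and \<open>z\<close> or
  between \<open>z\<close> and \<open>x\<close>, and then on every geodesic joining these two points.\<close>

lemma geodesic_side_subset_union:
  assumes M: "Metric_space M d"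
    and four_point: "\<And>x y z w. \<lbrakk>x \<in> M; y \<in> M; z \<in> M; w \<in> M\<rbrakk>
       \<Longrightarrow> d x y + d z w \<le> max (d x z + d y w) (d x w + d y z)"
    and mem: "x \<in> M" "y \<in> M" "z \<in> M"
    and S: "geodesic_segment M d x y S1" "geodesic_segment M d y z S2" "geodesic_segment M d z x S3"
  shows "S1 \<subseteq> S2 \<union> S3"
proof
  interpret Metric_space M d by (fact M)
  fix p assume "p \<in> S1"
  then obtain \<gamma> \<tau> where \<gamma>: "\<gamma> ` {0..d x y} \<subseteq> M" "\<gamma> 0 = x" "\<gamma> (d x y) = y"
    "\<And>s t. \<lbrakk>s \<in> {0..d x y}; t \<in> {0..d x y}\<rbrakk> \<Longrightarrow> d (\<gamma> s) (\<gamma> t) = \<bar>s - t\<bar>"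
    and \<tau>: "\<tau> \<in> {0..d x y}" "p = \<gamma> \<tau>"
    using S(1) unfolding geodesic_segment_def by blast
  have p: "p \<in> M" using \<gamma>(1) \<tau> by blast
  have "d x p = \<tau>" "d p y = d x y - \<tau>"
    using \<gamma>(4)[of 0 \<tau>] \<gamma>(4)[of \<tau> "d x y"] \<gamma>(2,3) \<tau> by auto
  then have sum: "d x y + d p z \<le> max (d x p + d y z) (d x z + d p y)" and xy: "d x y = d x p + d p y"
    using four_point[of x y p z] mem p commute[of y p] by simp_all
  then consider "d y p + d p z \<le> d y z" | "d z p + d p x \<le> d z x"
    using commute[of y p] commute[of z p] commute[of x p] commute[of z x] by linarith
  then show "p \<in> S2 \<union> S3"
  proof cases
    case 1
    then have "d y p + d p z = d y z" using triangle[of y p z] mem p by simp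
    then show ?thesis using between_mem_geodesic_segment[OF M four_point S(2)] mem p by blast
  next
    case 2
    then have "d z p + d p x = d z x" using triangle[of z p x] mem p by simp
    then show ?thesis using between_mem_geodesic_segment[OF M four_point S(3)] mem p by blast
  qed
qed

lemma four_point_imp_metric_tree:
  assumes geo: "geodesic_space M d"
    and four_point: "\<And>x y z w. \<lbrakk>x \<in> M; y \<in> M; z \<in> M; w \<in> M\<rbrakk>
       \<Longrightarrow> d x y + d z w \<le> max (d x z + d y w) (d x w + d y z)"
  shows "metric_tree M d"
proof -
  have M: "Metric_space M d" using geo by (simp add: geodesic_space_def)
  note side = geodesic_side_subset_union[OF M four_point]
  show ?thesis
    unfolding metric_tree_def
    by (intro conjI ballI allI impI geo) (elim conjE, rule side; assumption)+
qed

section \<open>The tree of merging rays\<close>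

text \<open>Think of \<open>U x y\<close> as the height at which upward rays starting over \<open>x\<close> and \<open>y\<close> merge; the ray over \<open>x\<close>
  starts at height \<open>U x x\<close>, and the ultrametric inequality says that rays stay together once they
  have merged.\<close>

locale merging_heights =
  fixes X :: "'a set" and U :: "'a \<Rightarrow> 'a \<Rightarrow> real"
  assumes U_commute: "\<lbrakk>x \<in> X; y \<in> X\<rbrakk> \<Longrightarrow> U x y = U y x"
    and U_ultra: "\<lbrakk>x \<in> X; y \<in> X; z \<in> X\<rbrakk> \<Longrightarrow> U x z \<le> max (U x y) (U y z)"
begin

definition points :: "('a \<times> real) set" where
  "points = {(x, s). x \<in> X \<and> U x x \<le> s}"

definition meet :: "'a \<times> real \<Rightarrow> 'a \<times> real \<Rightarrow> real" where
  "meet P Q = max (max (snd P) (snd Q)) (U (fst P) (fst Q))"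

text \<open>The pairs \<open>(x, s)\<close> and \<open>(y, s)\<close> stand for the same point of the tree when \<open>U x y \<le> s\<close>. Choosing one
  pair in each class keeps the tree a set of pairs instead of a set of classes.\<close>

definition rep :: "'a \<times> real \<Rightarrow> 'a \<times> real" where
  "rep P = (SOME y. y \<in> X \<and> U (fst P) y \<le> snd P, snd P)"

definition tree :: "('a \<times> real) set" where
  "tree = rep ` points"

definition tree_dist :: "'a \<times> real \<Rightarrow> 'a \<times> real \<Rightarrow> real" where
  "tree_dist P Q = (if P \<in> tree \<and> Q \<in> tree then 2 * meet P Q - snd P - snd Q else 0)"

lemma U_self_le: "\<lbrakk>x \<in> X; y \<in> X\<rbrakk> \<Longrightarrow> U x x \<le> U x y"
  using U_ultra[of x y x] U_commute[of x y] by simp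

lemma rep_props:
  assumes "P \<in> points"
  shows "fst (rep P) \<in> X" "U (fst P) (fst (rep P)) \<le> snd P" "snd (rep P) = snd P"
proof -
  have "fst P \<in> X \<and> U (fst P) (fst P) \<le> snd P"
    using assms by (auto simp: points_def)
  then have "fst (rep P) \<in> X \<and> U (fst P) (fst (rep P)) \<le> snd P"
    unfolding rep_def fst_conv by (rule someI)
  then show "fst (rep P) \<in> X" "U (fst P) (fst (rep P)) \<le> snd P" "snd (rep P) = snd P"
    by (auto simp: rep_def)
qed

lemma rep_mem_points: "P \<in> points \<Longrightarrow> rep P \<in> points"
  using rep_props[of P] U_self_le[of "fst (rep P)" "fst P"] U_commute[of "fst P" "fst (rep P)"]
  by (cases P, cases "rep P") (auto simp: points_def)

lemma tree_subset_points: "tree \<subseteq> points"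
  using rep_mem_points by (auto simp: tree_def)

lemma meet_commute: "\<lbrakk>P \<in> points; Q \<in> points\<rbrakk> \<Longrightarrow> meet P Q = meet Q P"
  using U_commute[of "fst P" "fst Q"] by (auto simp: meet_def points_def)

lemma meet_ultra:
  "\<lbrakk>P \<in> points; Q \<in> points; R \<in> points\<rbrakk> \<Longrightarrow> meet P R \<le> max (meet P Q) (meet Q R)"
  using U_ultra[of "fst P" "fst Q" "fst R"] by (auto simp: meet_def points_def)

lemma meet_ge: "snd P \<le> meet P Q \<and> snd Q \<le> meet P Q"
  by (auto simp: meet_def)

lemma meet_self: "P \<in> points \<Longrightarrow> meet P P = snd P"
  by (auto simp: meet_def points_def)

lemma meet_rep_self: "P \<in> points \<Longrightarrow> meet P (rep P) = snd P"
  using rep_props[of P] by (auto simp: meet_def)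

lemma meet_rep:
  assumes "P \<in> points" "Q \<in> points"
  shows "meet (rep P) (rep Q) = meet P Q"
proof -
  note mem = assms rep_mem_points[OF assms(1)] rep_mem_points[OF assms(2)]
  note ge = meet_ge[of P Q] meet_ge[of "rep P" "rep Q"] meet_ge[of P "rep Q"] meet_ge[of "rep P" Q]
  have "meet (rep P) (rep Q) \<le> max (snd P) (meet P (rep Q))"
    using meet_ultra[of "rep P" P "rep Q"] mem meet_rep_self[of P] meet_commute[of P "rep P"] by simp
  moreover have "meet P (rep Q) \<le> max (meet P Q) (snd Q)"
    using meet_ultra[of P Q "rep Q"] mem meet_rep_self[of Q] by simp
  moreover have "meet P Q \<le> max (snd P) (meet (rep P) Q)"
    using meet_ultra[of P "rep P" Q] mem meet_rep_self[of P] by simp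
  moreover have "meet (rep P) Q \<le> max (meet (rep P) (rep Q)) (snd Q)"
    using meet_ultra[of "rep P" "rep Q" Q] mem meet_rep_self[of Q] meet_commute[of Q "rep Q"] by simp
  ultimately show ?thesis
    using ge rep_props(3)[OF assms(1)] rep_props(3)[OF assms(2)] by linarith
qed

lemma rep_eq:
  assumes "P \<in> points" "Q \<in> points" "snd P = snd Q" "meet P Q = snd P"
  shows "rep P = rep Q"
proof -
  have PQ: "U (fst P) (fst Q) \<le> snd P" using assms(4) by (simp add: meet_def)
  have "y \<in> X \<and> U (fst P) y \<le> snd P \<longleftrightarrow> y \<in> X \<and> U (fst Q) y \<le> snd Q" for y
    using assms(1-3) PQ U_ultra[of "fst P" "fst Q" y] U_ultra[of "fst Q" "fst P" y]
      U_commute[of "fst P" "fst Q"]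
    by (auto simp: points_def)
  then show ?thesis using assms(3) by (simp add: rep_def)
qed

lemma rep_tree: "P \<in> tree \<Longrightarrow> rep P = P"
proof -
  assume "P \<in> tree"
  then obtain Q where Q: "Q \<in> points" "P = rep Q" by (auto simp: tree_def)
  have "rep Q = rep (rep Q)"
    by (rule rep_eq) (use Q rep_mem_points meet_rep_self rep_props(3) in auto)
  then show ?thesis using Q by simp
qed

lemma tree_dist_rep:
  "\<lbrakk>P \<in> points; Q \<in> points\<rbrakk> \<Longrightarrow> tree_dist (rep P) (rep Q) = 2 * meet P Q - snd P - snd Q"
  by (simp add: tree_dist_def tree_def meet_rep rep_props(3))

lemma tree_dist_eq_0_imp_eq:
  assumes "P \<in> tree" "Q \<in> tree" "tree_dist P Q = 0"
  shows "P = Q"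
proof -
  have "2 * meet P Q = snd P + snd Q"
    using assms by (simp add: tree_dist_def)
  with meet_ge[of P Q] have "snd P = snd Q" "meet P Q = snd P" by linarith+
  then have "rep P = rep Q"
    using rep_eq assms tree_subset_points by blast
  then show ?thesis using rep_tree assms by simp
qed

lemma Metric_space_tree: "Metric_space tree tree_dist"
proof
  show "0 \<le> tree_dist P Q" for P Q
    using meet_ge[of P Q] by (simp add: tree_dist_def)
  show "tree_dist P Q = tree_dist Q P" for P Q
    using meet_commute[of P Q] tree_subset_points by (auto simp: tree_dist_def)
  show "tree_dist P Q = 0 \<longleftrightarrow> P = Q" if "P \<in> tree" "Q \<in> tree" for P Q
    using tree_dist_eq_0_imp_eq[of P Q] meet_self[of P] tree_subset_points that
    by (auto simp: tree_dist_def)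
  show "tree_dist P R \<le> tree_dist P Q + tree_dist Q R"
    if "P \<in> tree" "Q \<in> tree" "R \<in> tree" for P Q R
    using that meet_ultra[of P Q R] meet_ge[of P Q] meet_ge[of Q R]
      that[THEN subsetD[OF tree_subset_points]]
    by (simp add: tree_dist_def) linarith
qed

text \<open>The heights of the four points contribute equally to the three sums. Among the three sums of
  merging heights, the ultrametric inequality makes the two largest ones equal.\<close>

lemma tree_dist_four_point:
  assumes "P \<in> tree" "Q \<in> tree" "R \<in> tree" "S \<in> tree"
  shows "tree_dist P Q + tree_dist R S
    \<le> max (tree_dist P R + tree_dist Q S) (tree_dist P S + tree_dist Q R)"
proof -
  note pts = assms[THEN subsetD[OF tree_subset_points]]
  have "meet P Q \<le> max (meet P R) (meet Q R)" "meet P Q \<le> max (meet P S) (meet Q S)"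
    "meet R S \<le> max (meet P R) (meet P S)" "meet R S \<le> max (meet Q R) (meet Q S)"
    using meet_ultra[of P R Q] meet_ultra[of P S Q] meet_ultra[of R P S] meet_ultra[of R Q S]
    by (simp_all add: pts meet_commute[of R P] meet_commute[of R Q] meet_commute[of S Q])
  then have "meet P Q + meet R S \<le> max (meet P R + meet Q S) (meet P S + meet Q R)"
    by (simp add: le_max_iff_disj) linarith
  then show ?thesis
    using assms by (simp add: tree_dist_def)
qed

lemma tree_geodesic:
  assumes "P \<in> tree" "Q \<in> tree"
  shows "\<exists>S. geodesic_segment tree tree_dist P Q S"
proof -
  obtain x s y t where P: "P = (x, s)" and Q: "Q = (y, t)" by fastforce
  define w where "w = meet P Q"
  define l where "l = tree_dist P Q"
  \<comment> \<open>The path climbs from \<open>P\<close> to the height \<open>w\<close> at which its ray meets that of \<open>Q\<close>, then descends to \<open>Q\<close>.\<close>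
  define g where "g \<tau> = (if \<tau> \<le> w - s then (x, s + \<tau>) else (y, t + (l - \<tau>)))" for \<tau>
  have pts: "P \<in> points" "Q \<in> points" using assms tree_subset_points by auto
  then have xy: "x \<in> X" "U x x \<le> s" "y \<in> X" "U y y \<le> t" by (auto simp: points_def P Q)
  have w: "s \<le> w" "t \<le> w" "U x y \<le> w" and w_cases: "w = s \<or> w = t \<or> w = U x y"
    by (auto simp: w_def meet_def P Q)
  have l: "l = 2 * w - s - t"
    using assms by (simp add: l_def w_def tree_dist_def P Q)
  have g_points: "g \<tau> \<in> points" if "\<tau> \<in> {0..l}" for \<tau>
    using that xy by (auto simp: g_def points_def)
  have g_dist: "2 * meet (g \<sigma>) (g \<tau>) - snd (g \<sigma>) - snd (g \<tau>) = \<tau> - \<sigma>"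
    if "\<sigma> \<in> {0..l}" "\<tau> \<in> {0..l}" "\<sigma> \<le> \<tau>" for \<sigma> \<tau>
  proof -
    consider "\<tau> \<le> w - s" | "\<sigma> \<le> w - s" "w - s < \<tau>" | "w - s < \<sigma>" using that by linarith
    then show ?thesis
    proof cases
      case 2
      \<comment> \<open>If \<open>w\<close> is the height of \<open>P\<close> or \<open>Q\<close> instead of \<open>U x y\<close>, one branch of the path is a single point.\<close>
      have "max (max (s + \<sigma>) (t + (l - \<tau>))) (U x y) = w"
        using w_cases w that 2 l by auto
      then show ?thesis using 2 l by (auto simp: g_def meet_def)
    qed (use that xy l in \<open>auto simp: g_def meet_def\<close>)
  qed
  have g_iso: "tree_dist (rep (g \<sigma>)) (rep (g \<tau>)) = \<bar>\<sigma> - \<tau>\<bar>"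
    if "\<sigma> \<in> {0..l}" "\<tau> \<in> {0..l}" for \<sigma> \<tau>
    using that g_dist[of \<sigma> \<tau>] g_dist[of \<tau> \<sigma>] g_points meet_commute[of "g \<sigma>" "g \<tau>"]
    by (cases "\<sigma> \<le> \<tau>") (auto simp: tree_dist_rep)
  have "g 0 = P" using w by (simp add: g_def P)
  then have start: "rep (g 0) = P" using rep_tree assms by simp
  have stop: "rep (g l) = Q"
  proof (cases "l \<le> w - s")
    case True
    then have "w = t" using l w by simp
    then have "g l = (x, t)" "meet (g l) Q = t" using True l w by (auto simp: g_def meet_def Q)
    moreover have "0 \<le> l" using l w by simp
    ultimately have "rep (g l) = rep Q"
      using rep_eq[of "g l" Q] g_points[of l] pts Q by simp
    then show ?thesis using rep_tree assms by simp
  next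
    case False
    then show ?thesis using rep_tree assms by (simp add: g_def Q)
  qed
  show ?thesis
    unfolding geodesic_segment_def
    using start stop g_iso g_points tree_def
    by (intro exI[of _ "(rep \<circ> g) ` {0..l}"] exI[of _ "rep \<circ> g"]) (auto simp flip: l_def)
qed

lemma metric_tree_tree: "metric_tree tree tree_dist"
  by (rule four_point_imp_metric_tree)
    (auto simp: geodesic_space_def Metric_space_tree tree_geodesic tree_dist_four_point)

end

text \<open>Each \<open>x\<close> is sent to the starting point of its ray.\<close>

lemma merging_heights_embed_in_metric_tree:
  fixes X :: "'a set" and U :: "'a \<Rightarrow> 'a \<Rightarrow> real"
  assumes "\<And>x y. \<lbrakk>x \<in> X; y \<in> X\<rbrakk> \<Longrightarrow> U x y = U y x"
    and "\<And>x y z. \<lbrakk>x \<in> X; y \<in> X; z \<in> X\<rbrakk> \<Longrightarrow> U x z \<le> max (U x y) (U y z)"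
  shows "\<exists>(T :: ('a \<times> real) set) dT f. metric_tree T dT \<and> f ` X \<subseteq> T \<and>
     (\<forall>x\<in>X. \<forall>y\<in>X. dT (f x) (f y) = 2 * U x y - U x x - U y y)"
proof -
  interpret merging_heights X U by unfold_locales (use assms in auto)
  define f where "f x = rep (x, U x x)" for x
  have pts: "(x, U x x) \<in> points" if "x \<in> X" for x using that by (simp add: points_def)
  have "f ` X \<subseteq> tree" using pts by (auto simp: f_def tree_def)
  moreover have "tree_dist (f x) (f y) = 2 * U x y - U x x - U y y" if "x \<in> X" "y \<in> X" for x y
    using tree_dist_rep[OF pts[OF that(1)] pts[OF that(2)]] that U_self_le[of x y] U_self_le[of y x]
      U_commute[of x y]
    by (simp add: f_def meet_def)
  ultimately show ?thesis using metric_tree_tree by blast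
qed

section \<open>Bottleneck costs\<close>

text \<open>Chains are encoded by transitive closures: \<open>y\<close> can be reached from \<open>x\<close> by jumps of cost at most \<open>h\<close>. The
  closure is not reflexive, because even a chain from \<open>x\<close> to itself has to pay for being at \<open>x\<close>.\<close>

definition steps_within :: "'a set \<Rightarrow> ('a \<Rightarrow> 'a \<Rightarrow> real) \<Rightarrow> real \<Rightarrow> ('a \<times> 'a) set" where
  "steps_within X c h = {(a, b). a \<in> X \<and> b \<in> X \<and> c a b \<le> h}"

definition bottleneck :: "'a set \<Rightarrow> ('a \<Rightarrow> 'a \<Rightarrow> real) \<Rightarrow> 'a \<Rightarrow> 'a \<Rightarrow> real" where
  "bottleneck X c x y = Inf {h. (x, y) \<in> (steps_within X c h)\<^sup>+}"

lemma steps_within_mono: "h \<le> h' \<Longrightarrow> (steps_within X c h)\<^sup>+ \<subseteq> (steps_within X c h')\<^sup>+"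
  by (rule subsetI, erule trancl_mono) (auto simp: steps_within_def)

lemma mem_steps_within_cost: "\<lbrakk>x \<in> X; y \<in> X\<rbrakk> \<Longrightarrow> (x, y) \<in> (steps_within X c (c x y))\<^sup>+"
  by (rule r_into_trancl) (simp add: steps_within_def)

lemma bottleneck_ge_start:
  assumes "x \<in> X" "y \<in> X" and "\<And>z. z \<in> X \<Longrightarrow> H \<le> c x z"
  shows "H \<le> bottleneck X c x y"
  unfolding bottleneck_def
proof (rule cInf_greatest)
  show "{h. (x, y) \<in> (steps_within X c h)\<^sup>+} \<noteq> {}"
    using mem_steps_within_cost[OF assms(1,2)] by blast
  fix h assume "h \<in> {h. (x, y) \<in> (steps_within X c h)\<^sup>+}"
  then obtain z where "(x, z) \<in> steps_within X c h" using tranclD[of x y "steps_within X c h"] by blast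
  then show "H \<le> h" using assms(3)[of z] by (auto simp: steps_within_def)
qed

text \<open>Every chain that starts in \<open>V\<close> and ends outside contains a jump leaving \<open>V\<close>.\<close>

lemma bottleneck_ge_cut:
  assumes "x \<in> X" "y \<in> X" "x \<in> V" "y \<notin> V"
    and cut: "\<And>a b. \<lbrakk>a \<in> X; a \<in> V; b \<in> X; b \<notin> V\<rbrakk> \<Longrightarrow> H \<le> c a b"
  shows "H \<le> bottleneck X c x y"
  unfolding bottleneck_def
proof (rule cInf_greatest)
  show "{h. (x, y) \<in> (steps_within X c h)\<^sup>+} \<noteq> {}"
    using mem_steps_within_cost[OF assms(1,2)] by blast
  fix h assume "h \<in> {h. (x, y) \<in> (steps_within X c h)\<^sup>+}"
  then have "(x, y) \<in> (steps_within X c h)\<^sup>+" by simp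
  then have "y \<in> V \<or> H \<le> h"
  proof (induction rule: trancl_induct)
    case (base b)
    then show ?case using order_trans[OF cut[of x b]] \<open>x \<in> V\<close> unfolding steps_within_def by blast
  next
    case (step a b)
    then show ?case using order_trans[OF cut[of a b]] unfolding steps_within_def by blast
  qed
  then show "H \<le> h" using \<open>y \<notin> V\<close> by blast
qed

lemma bottleneck_commute:
  assumes "\<And>a b. \<lbrakk>a \<in> X; b \<in> X\<rbrakk> \<Longrightarrow> c a b = c b a"
  shows "bottleneck X c x y = bottleneck X c y x"
proof -
  have conv: "(steps_within X c h)\<inverse> = steps_within X c h" for h
    using assms by (auto simp: steps_within_def)
  have "(y, x) \<in> (steps_within X c h)\<^sup>+ \<longleftrightarrow> (x, y) \<in> (steps_within X c h)\<^sup>+" for h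
    using trancl_converse[of "steps_within X c h"] unfolding conv by blast
  then show ?thesis by (simp add: bottleneck_def)
qed

text \<open>The function \<open>u\<close> keeps the infima in the definition of the bottleneck away from \<open>-\<infinity>\<close>.\<close>

context
  fixes X :: "'a set" and c :: "'a \<Rightarrow> 'a \<Rightarrow> real" and u :: "'a \<Rightarrow> real"
  assumes u_le: "\<And>a b. \<lbrakk>a \<in> X; b \<in> X\<rbrakk> \<Longrightarrow> u a \<le> c a b"
begin

lemma bottleneck_le:
  assumes "x \<in> X" "(x, y) \<in> (steps_within X c h)\<^sup>+"
  shows "bottleneck X c x y \<le> h"
  unfolding bottleneck_def
proof (rule cInf_lower)
  show "bdd_below {h. (x, y) \<in> (steps_within X c h)\<^sup>+}"
  proof (rule bdd_belowI[of _ "u x"])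
    fix h assume "h \<in> {h. (x, y) \<in> (steps_within X c h)\<^sup>+}"
    then obtain z where "(x, z) \<in> steps_within X c h" using tranclD[of x y "steps_within X c h"] by blast
    then show "u x \<le> h" using u_le[of x z] by (auto simp: steps_within_def)
  qed
qed (use assms in simp)

lemma bottleneck_le_cost: "\<lbrakk>x \<in> X; y \<in> X\<rbrakk> \<Longrightarrow> bottleneck X c x y \<le> c x y"
  by (rule bottleneck_le[OF _ mem_steps_within_cost])

lemma bottleneck_ultra:
  assumes "x \<in> X" "y \<in> X" "z \<in> X"
  shows "bottleneck X c x z \<le> max (bottleneck X c x y) (bottleneck X c y z)"
proof (rule ccontr)
  let ?S = "\<lambda>x y. {h. (x, y) \<in> (steps_within X c h)\<^sup>+}"
  assume "\<not> ?thesis"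
  then have less: "Inf (?S x y) < bottleneck X c x z" "Inf (?S y z) < bottleneck X c x z"
    by (auto simp: bottleneck_def)
  have "?S x y \<noteq> {}" "?S y z \<noteq> {}"
    using mem_steps_within_cost[OF assms(1,2), of c] mem_steps_within_cost[OF assms(2,3), of c] by blast+
  from cInf_lessD[OF this(1) less(1)] cInf_lessD[OF this(2) less(2)]
  obtain h h' where h: "h \<in> ?S x y" "h < bottleneck X c x z" "h' \<in> ?S y z" "h' < bottleneck X c x z"
    by blast
  then have "(x, z) \<in> (steps_within X c (max h h'))\<^sup>+"
    using steps_within_mono[of h "max h h'" X c] steps_within_mono[of h' "max h h'" X c]
    by (intro trancl_trans[of x y _ z]) (blast intro: max.cobounded1 max.cobounded2)+
  then have "bottleneck X c x z \<le> max h h'" by (rule bottleneck_le[OF assms(1)])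
  then show False using h by simp
qed

end

section \<open>One tree for each colour\<close>

lemma exists_scale:
  fixes r t :: real
  assumes "r > 1" "t > 0"
  shows "\<exists>j::int. r powr j \<le> t \<and> t < r powr of_int (j + 1)"
proof -
  let ?j = "\<lfloor>log r t\<rfloor>"
  have "log r t < of_int ?j + 1" by linarith
  then have "r powr ?j \<le> r powr log r t" "r powr log r t < r powr (?j + 1)"
    using assms(1) powr_mono[OF of_int_floor_le, of r "log r t"]
      powr_less_mono[of "log r t" "of_int ?j + 1" r] by simp_all
  moreover have "r powr log r t = t" using assms by simp
  ultimately show ?thesis by (intro exI[of _ ?j]) simp
qed

text \<open>The distance in the tree is \<open>2 U(x, y) - u(x) - u(y)\<close>, where \<open>U\<close> is the bottleneck of the costs below.
  The upper bound comes from the single jump from \<open>x\<close> to \<open>y\<close> and from the Hoelder continuity of \<open>u\<close>. For the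
  lower bound it suffices that every jump leaving the \<open>r\<^sup>j\<close>-neighbourhood of \<open>C\<close> costs at least \<open>u(x)\<close> plus half
  of \<open>r\<^sup>j\<^sup>p\<close>. Either the jump is longer than \<open>r\<^sup>j\<close>, and its length pays for this, because near \<open>C\<close> the
  height is not much smaller than \<open>u(x)\<close>; or it ends at a point with distance less than \<open>2 r\<^sup>j\<close> from
  \<open>C\<close> and at least \<open>r\<^sup>j\<close> from the whole family, where the \<open>j\<close>-th term of the height is maximal.
  All points concerned are within \<open>(c + 2) r\<^sup>j\<close> of \<open>x\<close>, which is the range in which the height is
  controlled by its \<open>j\<close>-th term.\<close>

lemma (in Metric_space) tree_of_scattered_families:
  fixes F :: "int \<Rightarrow> 'a set set" and r p c :: real
  assumes r: "r > 1" and p: "0 < p" and c: "c > 0"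
    and q_big: "r powr p \<ge> 5" and t_big: "r powr (1 - p) \<ge> 4 * (c + 2) + 1"
    and sub: "\<And>j. \<Union> (F j) \<subseteq> M"
    and scattered: "\<And>j. scattered d c (r powr j) (F j)"
  shows "\<exists>(T :: ('a \<times> real) set) dT f. metric_tree T dT \<and> f ` M \<subseteq> T \<and>
    (\<forall>x\<in>M. \<forall>y\<in>M. dT (f x) (f y) \<le> (2 * r powr p + 2) * d x y powr p) \<and>
    (\<forall>j. \<forall>C\<in>F j. \<forall>x\<in>C. \<forall>y\<in>M. (c + 1) * r powr j \<le> d x y \<longrightarrow>
       r powr (p * j) / 2 \<le> dT (f x) (f y))"
proof -
  have bounded: "d x y \<le> c * r powr j" if "C \<in> F j" "x \<in> C" "y \<in> C" for j :: int and C x y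
    using scattered[of j] that by (simp add: scattered_def)
  have separated: "3 * r powr j \<le> d x y"
    if "C \<in> F j" "C' \<in> F j" "C \<noteq> C'" "x \<in> C" "y \<in> C'" for j :: int and C C' x y
    using scattered[of j] that by (simp add: scattered_def)
  define g where "g j x = trunc_dist d (r powr j) (\<Union> (F j)) x / r powr j" for j :: int and x
  have rpos: "r powr a > 0" for a using r by simp
  have g_range: "0 \<le> g j x \<and> g j x \<le> 1" for j x
    using trunc_dist_bounds[of "r powr j"] rpos[of j] by (simp add: g_def divide_le_eq)
  have g_lip: "\<bar>g j x - g j y\<bar> \<le> d x y / r powr j" if "x \<in> M" "y \<in> M" for j x y
    using trunc_dist_lipschitz[OF _ sub that, of "r powr j" j] rpos[of j]
    by (simp add: g_def diff_divide_distrib[symmetric] abs_divide divide_right_mono)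
  have c2: "c + 2 \<ge> 1" using c by simp
  have "\<exists>u. \<forall>x\<in>M. \<forall>y\<in>M. \<forall>j::int. d x y \<le> (c + 2) * r powr j \<longrightarrow>
    \<bar>u x - u y - r powr (p * j) * (g j x - g j y)\<bar> \<le> r powr (p * j) / 2"
    by (rule multiscale_sum[OF r q_big t_big c2 g_range]) (rule g_lip)
  then obtain u where u: "\<And>x y j. \<lbrakk>x \<in> M; y \<in> M; d x y \<le> (c + 2) * r powr of_int j\<rbrakk> \<Longrightarrow>
    \<bar>u x - u y - r powr (p * j) * (g j x - g j y)\<bar> \<le> r powr (p * j) / 2"
    by metis
  define cost where "cost x y = max (u x) (u y) + d x y powr p" for x y
  define U where "U = bottleneck M cost"
  have u_cost: "u a \<le> cost a b" "u b \<le> cost a b" for a b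
    using powr_ge_zero[of "d a b" p] unfolding cost_def by linarith+
  have cost_commute: "cost a b = cost b a" for a b
    using commute[of a b] by (simp add: cost_def max.commute)
  have U_commute: "U x y = U y x" for x y
    unfolding U_def by (rule bottleneck_commute) (rule cost_commute)
  have U_ultra: "U x z \<le> max (U x y) (U y z)" if "x \<in> M" "y \<in> M" "z \<in> M" for x y z
    unfolding U_def by (rule bottleneck_ultra[OF u_cost(1) that])
  have U_ge: "u x \<le> U x y" if "x \<in> M" "y \<in> M" for x y
    unfolding U_def by (rule bottleneck_ge_start[OF that u_cost(1)])
  have U_le: "U x y \<le> cost x y" if "x \<in> M" "y \<in> M" for x y
    unfolding U_def by (rule bottleneck_le_cost[OF u_cost(1) that])
  have U_self: "U x x = u x" if "x \<in> M" for x
    using U_ge[OF that that] U_le[OF that that] that by (simp add: cost_def)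
  have "\<exists>(T :: ('a \<times> real) set) dT f. metric_tree T dT \<and> f ` M \<subseteq> T \<and>
     (\<forall>x\<in>M. \<forall>y\<in>M. dT (f x) (f y) = 2 * U x y - U x x - U y y)"
    by (rule merging_heights_embed_in_metric_tree) (rule U_commute, rule U_ultra)
  then obtain T :: "('a \<times> real) set" and dT f where T: "metric_tree T dT \<and> f ` M \<subseteq> T \<and>
     (\<forall>x\<in>M. \<forall>y\<in>M. dT (f x) (f y) = 2 * U x y - U x x - U y y)"
    by (elim exE) (rule that)
  then have dT: "dT (f x) (f y) = 2 * U x y - U x x - U y y" if "x \<in> M" "y \<in> M" for x y
    using that by blast
  have upper: "dT (f x) (f y) \<le> (2 * r powr p + 2) * d x y powr p" if xy: "x \<in> M" "y \<in> M" for x y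
  proof (cases "x = y")
    case True
    then show ?thesis using dT xy by simp
  next
    case False
    then have pos: "d x y > 0" using xy by (simp add: less_le)
    obtain j :: int where j: "r powr j \<le> d x y" "d x y < r powr (j + 1)"
      using exists_scale[OF r pos] by (elim exE conjE) (rule that)
    \<comment> \<open>The height is compared at the next larger scale, which is above \<open>d x y\<close>.\<close>
    let ?a = "r powr (p * of_int (j + 1))"
    have "1 * r powr (j + 1) \<le> (c + 2) * r powr of_int (j + 1)"
      using c by (intro mult_mono) auto
    then have "d x y \<le> (c + 2) * r powr of_int (j + 1)" using j(2) by linarith
    moreover have "\<bar>?a * (g (j + 1) x - g (j + 1) y)\<bar> = ?a * \<bar>g (j + 1) x - g (j + 1) y\<bar>"
      by (simp add: abs_mult)
    ultimately have "\<bar>u x - u y\<bar> \<le> ?a * \<bar>g (j + 1) x - g (j + 1) y\<bar> + ?a / 2"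
      using u[OF xy, of "j + 1"] by linarith
    also have "\<dots> \<le> ?a * 1 + ?a / 2"
      using g_range[of "j + 1" x] g_range[of "j + 1" y] by (intro add_mono mult_left_mono) auto
    also have "\<dots> \<le> 2 * ?a" using rpos by simp
    also have "?a = r powr p * (r powr j) powr p"
      by (simp add: powr_powr powr_add[symmetric] algebra_simps)
    also have "\<dots> \<le> r powr p * d x y powr p"
      using j(1) p rpos by (intro mult_left_mono powr_mono2) auto
    finally have "\<bar>u x - u y\<bar> \<le> 2 * (r powr p * d x y powr p)" by simp
    moreover have "dT (f x) (f y) \<le> \<bar>u x - u y\<bar> + 2 * d x y powr p"
      using U_le[OF xy] dT[OF xy] xy by (simp add: U_self cost_def)
    ultimately show ?thesis by (simp add: algebra_simps)
  qed
  have lower: "r powr (p * j) / 2 \<le> dT (f x) (f y)"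
    if C: "C \<in> F j" "x \<in> C" and y: "y \<in> M" and far: "(c + 1) * r powr j \<le> d x y" for j :: int and C x y
  proof -
    let ?\<rho> = "r powr j" and ?a = "r powr (p * j)"
    let ?V = "{a. \<exists>z\<in>C. d a z < ?\<rho>}"
    have CM: "C \<subseteq> M" using sub C by blast
    then have x: "x \<in> M" using C by blast
    have \<rho>p: "?\<rho> powr p = ?a" by (simp add: powr_powr mult.commute)
    have "g j x = 0" using trunc_dist_mem[of ?\<rho> x] C x by (auto simp: g_def)
    have x_le: "u x \<le> u b - ?a * g j b + ?a / 2" if "b \<in> M" "d x b \<le> (c + 2) * ?\<rho>" for b
    proof -
      have "?a * (g j x - g j b) = - (?a * g j b)" using \<open>g j x = 0\<close> by simp
      then show ?thesis using u[OF x that] by linarith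
    qed
    have "u x + ?a / 2 \<le> U x y"
      unfolding U_def
    proof (rule bottleneck_ge_cut[OF x y, of ?V])
      have "d x x < ?\<rho>" using x rpos by simp
      then show "x \<in> ?V" using C(2) by blast
      show "y \<notin> ?V"
      proof
        assume "y \<in> ?V"
        then obtain z where z: "z \<in> C" "d y z < ?\<rho>" by blast
        then have "z \<in> M" using CM by blast
        then have "d x y \<le> d x z + d y z" using triangle[OF x _ y] commute[of y z] by simp
        then have "d x y < c * ?\<rho> + ?\<rho>" using bounded[OF C z(1)] z(2) by linarith
        then show False using far by (simp only: distrib_right mult_1)
      qed
    next
      fix a b assume a: "a \<in> M" "a \<in> ?V" and b: "b \<in> M" "b \<notin> ?V"
      obtain z where z: "z \<in> C" "d a z < ?\<rho>" using a by blast
      then have "z \<in> M" using CM by blast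
      have "d x a \<le> d x z + d a z" using triangle[OF x \<open>z \<in> M\<close> a(1)] commute[of a z] by simp
      then have xa: "d x a \<le> c * ?\<rho> + ?\<rho>" using bounded[OF C z(1)] z(2) by linarith
      show "u x + ?a / 2 \<le> cost a b"
      proof (cases "?\<rho> \<le> d a b")
        case True
        then have "?a \<le> d a b powr p"
          unfolding \<rho>p[symmetric] using p rpos by (intro powr_mono2) auto
        moreover have "u x \<le> u a + ?a / 2"
        proof -
          have "d x a \<le> (c + 2) * ?\<rho>" using xa rpos[of j] unfolding distrib_right by linarith
          from x_le[OF a(1) this] show ?thesis
            using mult_nonneg_nonneg[of ?a "g j a"] g_range[of j a] less_imp_le[OF rpos[of "p * j"]]
            by linarith
        qed
        moreover have "u a + d a b powr p \<le> cost a b" by (simp add: cost_def)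
        ultimately show ?thesis by linarith
      next
        case False
        have "d z b \<le> d a z + d a b"
          using triangle[OF \<open>z \<in> M\<close> a(1) b(1)] commute[of a z] by simp
        then have zb: "d z b < 2 * ?\<rho>" using False z(2) by linarith
        have "?\<rho> \<le> d b w" if w: "C' \<in> F j" "w \<in> C'" for C' w
        proof (cases "C' = C")
          case True
          then show ?thesis using b(2) w(2) by (simp add: not_less)
        next
          case False
          then have "3 * ?\<rho> \<le> d z w" using separated[OF C(1) w(1) _ z(1) w(2)] by simp
          moreover have "d z w \<le> d z b + d b w"
            using triangle[OF \<open>z \<in> M\<close> b(1)] w sub[of j] by blast
          ultimately show ?thesis using zb by linarith
        qed
        then have "?\<rho> \<le> trunc_dist d ?\<rho> (\<Union> (F j)) b" by (intro trunc_dist_ge) auto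
        then have "g j b = 1" using g_range[of j b] rpos[of j] by (simp add: g_def le_divide_eq)
        have "d x b \<le> d x z + d z b" using triangle[of x z b] x b \<open>z \<in> M\<close> by simp
        then have "d x b \<le> (c + 2) * ?\<rho>" using bounded[OF C z(1)] zb unfolding distrib_right by linarith
        from x_le[OF b(1) this] have "u x + ?a / 2 \<le> u b" using \<open>g j b = 1\<close> by simp
        then show ?thesis using u_cost(2)[of b a] by linarith
      qed
    qed
    moreover have "u y \<le> U x y" using U_ge[OF y x] U_commute by simp
    ultimately show ?thesis using dT[OF x y] by (simp add: U_self x y)
  qed
  show ?thesis
    using T upper lower by (intro exI[of _ T] exI[of _ dT] exI[of _ f]) simp
qed

section \<open>The embedding\<close>

theorem theorem1p3:
  fixes X :: "'a set" and d :: "'a \<Rightarrow> 'a \<Rightarrow> real" and n :: int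
  assumes "Metric_space X d"
    and "nagata_dim X d \<le> ereal (of_int n)"
  shows "\<exists>p0>0. \<forall>p::real. 0 < p \<and> p < 1 \<and> p < p0 \<longrightarrow>
           embeds_in_product_of_trees n X (\<lambda>x x'. d x x' powr p)"
proof (intro exI[of _ 1] conjI allI impI)
  fix p :: real assume "0 < p \<and> p < 1 \<and> p < 1"
  then have p: "0 < p" "p < 1" by auto
  interpret Metric_space X d by (fact assms(1))
  obtain c where c: "c > 0" and families: "\<forall>s>0. \<exists>F :: int \<Rightarrow> 'a set set.
    X \<subseteq> (\<Union>k\<in>{0..n}. \<Union> (F k)) \<and> (\<forall>k. \<Union> (F k) \<subseteq> X \<and> scattered d c s (F k))"
    using nagata_coloured_coverings[OF nagata_property_of_dim_le[OF assms(2)]]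
    by (elim exE conjE) (rule that)
  \<comment> \<open>Large enough for both geometric series of \<open>multiscale_sum\<close> with range \<open>c + 2\<close>.\<close>
  define r where "r = max (5 powr (1 / p)) ((4 * (c + 2) + 1) powr (1 / (1 - p)))"
  have "5 = (5 powr (1 / p)) powr p" using p by (simp add: powr_powr)
  also have "\<dots> \<le> r powr p" using p by (intro powr_mono2) (auto simp: r_def)
  finally have q_big: "5 \<le> r powr p" .
  have "4 * (c + 2) + 1 = ((4 * (c + 2) + 1) powr (1 / (1 - p))) powr (1 - p)"
    using p c by (simp add: powr_powr)
  also have "\<dots> \<le> r powr (1 - p)" using p by (intro powr_mono2) (auto simp: r_def)
  finally have t_big: "4 * (c + 2) + 1 \<le> r powr (1 - p)" .
  have "1 < (5::real) powr (1 / p)" using p by (simp add: gr_one_powr)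
  then have r: "r > 1" by (simp add: r_def)
  have "\<forall>j::int. \<exists>F :: int \<Rightarrow> 'a set set.
    X \<subseteq> (\<Union>k\<in>{0..n}. \<Union> (F k)) \<and> (\<forall>k. \<Union> (F k) \<subseteq> X \<and> scattered d c (r powr j) (F k))"
    using families r by simp
  from choice[OF this] obtain F :: "int \<Rightarrow> int \<Rightarrow> 'a set set" where
    F: "\<forall>j. X \<subseteq> (\<Union>k\<in>{0..n}. \<Union> (F j k)) \<and>
      (\<forall>k. \<Union> (F j k) \<subseteq> X \<and> scattered d c (r powr j) (F j k))"
    by (elim exE) (rule that)
  let ?K = "2 * r powr p + 2"
  define tree_for where "tree_for k T dT f \<longleftrightarrow> metric_tree T dT \<and> f ` X \<subseteq> T \<and>
    (\<forall>x\<in>X. \<forall>y\<in>X. dT (f x) (f y) \<le> ?K * d x y powr p) \<and>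
    (\<forall>j. \<forall>C\<in>F j k. \<forall>x\<in>C. \<forall>y\<in>X. (c + 1) * r powr j \<le> d x y \<longrightarrow>
       r powr (p * j) / 2 \<le> dT (f x) (f y))" for k and T :: "('a \<times> real) set" and dT f
  have "\<exists>T dT f. tree_for k T dT f" for k
    unfolding tree_for_def
    by (rule tree_of_scattered_families[OF r p(1) c q_big t_big]) (use F in simp_all)
  then obtain T dT f where "\<And>k. tree_for k (T k) (dT k) (f k)" by metis
  then have T: "metric_tree (T k) (dT k)" "f k ` X \<subseteq> T k"
    and upper: "\<lbrakk>x \<in> X; y \<in> X\<rbrakk> \<Longrightarrow> dT k (f k x) (f k y) \<le> ?K * d x y powr p"
    and lower: "\<lbrakk>C \<in> F j k; x \<in> C; y \<in> X; (c + 1) * r powr j \<le> d x y\<rbrakk>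
      \<Longrightarrow> r powr (p * j) / 2 \<le> dT k (f k x) (f k y)" for j k C x y
    unfolding tree_for_def by simp_all
  define \<phi> where "\<phi> x = (\<lambda>k\<in>{0..n}. f k x)" for x
  let ?D = "\<lambda>x y. l2_product_dist {0..n} dT (\<phi> x) (\<phi> y)"
  have D_eq: "?D x y = L2_set (\<lambda>k. dT k (f k x) (f k y)) {0..n}" for x y
    unfolding l2_product_dist_def L2_set_def by (simp add: \<phi>_def)
  have dT_nonneg: "0 \<le> dT k P Q" for k P Q
    using T(1)[of k] Metric_space.nonneg by (auto simp: metric_tree_def geodesic_space_def)
  let ?b = "of_nat (card {0..n}) * ?K + 1" and ?a = "1 / (2 * ((c + 1) * r) powr p)"
  have D_le: "?D x y \<le> ?b * d x y powr p" if "x \<in> X" "y \<in> X" for x y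
  proof -
    have "?D x y \<le> (\<Sum>k\<in>{0..n}. dT k (f k x) (f k y))"
      unfolding D_eq by (rule L2_set_le_sum) (rule dT_nonneg)
    also have "\<dots> \<le> of_nat (card {0..n}) * (?K * d x y powr p)"
      by (rule sum_bounded_above) (rule upper[OF that])
    also have "\<dots> \<le> ?b * d x y powr p" by (simp add: algebra_simps)
    finally show ?thesis .
  qed
  have D_ge: "?a * d x y powr p \<le> ?D x y" if xy: "x \<in> X" "y \<in> X" for x y
  proof (cases "x = y")
    case True
    then show ?thesis using xy by (simp add: D_eq L2_set_nonneg)
  next
    case False
    then have pos: "d x y / (c + 1) > 0" using xy c by (simp add: less_le)
    \<comment> \<open>The largest scale at which the bound on diameters puts \<open>y\<close> outside the \<open>r\<^sup>j\<close>-neighbourhood of every member containing \<open>x\<close>.\<close>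
    obtain j :: int where j: "r powr j \<le> d x y / (c + 1)" "d x y / (c + 1) < r powr (j + 1)"
      using exists_scale[OF r pos] by (elim exE conjE) (rule that)
    obtain k C where k: "k \<in> {0..n}" "C \<in> F j k" "x \<in> C" using F xy(1) by blast
    have "d x y < (c + 1) * r * r powr j"
      using j(2) c r by (simp add: powr_add divide_less_eq algebra_simps)
    then have "d x y powr p \<le> ((c + 1) * r * r powr j) powr p"
      using p by (intro powr_mono2) auto
    also have "\<dots> = ((c + 1) * r) powr p * r powr (p * j)"
      using c r by (simp add: powr_mult powr_powr mult.commute)
    finally have "?a * d x y powr p \<le> ?a * (((c + 1) * r) powr p * r powr (p * j))"
      by (intro mult_left_mono) auto
    also have "\<dots> = r powr (p * j) / 2" using c r by simp
    also have "\<dots> \<le> dT k (f k x) (f k y)"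
      using lower[OF k(2,3) xy(2)] j(1) c by (simp add: le_divide_eq mult.commute)
    also have "\<dots> \<le> ?D x y"
      unfolding D_eq using k(1) by (intro member_le_L2_set) auto
    finally show ?thesis .
  qed
  have "?a > 0" "?b > 0" using c r by (auto intro!: add_nonneg_pos)
  moreover have "\<phi> ` X \<subseteq> PiE {0..n} T" using T(2) by (fastforce simp: \<phi>_def)
  ultimately have "bi_lipschitz_embedding X (\<lambda>x x'. d x x' powr p) (PiE {0..n} T)
     (l2_product_dist {0..n} dT) \<phi>"
    unfolding bi_lipschitz_embedding_def using D_le D_ge
    by (intro conjI exI[of _ ?a] exI[of _ ?b]) simp_all
  then show "embeds_in_product_of_trees n X (\<lambda>x x'. d x x' powr p)"
    unfolding embeds_in_product_of_trees_def using T(1)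
    by (intro exI[of _ T] exI[of _ dT] exI[of _ \<phi>]) simp
qed simp

end
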